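(* Let $f$, $\mathcal W$, $\pmb w^*$, $\pmb s_{\pmb z}$, and the SAPO iterates $\pmb w_{t+1}=\pmb w_t-\gamma\,\pmb s_{\pmb z_t}(\pmb w_t)$ (with fixed learning rate $\gamma$ and initial weight vector $\pmb w_0$) be as defined in the context. Assume: (i) $f$ is strongly convex with modulus $c$, that is, for all $\pmb w,\pmb w'\in\mathcal W$, $f(\pmb w')\ge f(\pmb w)+(\pmb w'-\pmb w)^T\nabla f(\pmb w)+\frac c2\|\pmb w'-\pmb w\|^2$; (ii) $\nabla f$ is Lipschitz continuous with constant $q$, that is, for all $\pmb w,\pmb w'\in\mathcal W$, $\|\nabla f(\pmb w')-\nabla f(\pmb w)\|\le q\|\pmb w'-\pmb w\|$; (iii) the norm of $\pmb s_{\pmb z}(\pmb w)$ is bounded by $\kappa\in\mathbb R^+$: $\|\pmb s_{\pmb z}(\pmb w)\|\le\kappa$; (iv) $\gamma c<1$. Let $\epsilon>0$ be a target degree of convergence. Let $\tau$ be an approximation-based bound from $\pmb s(\pmb w)$ to $\nabla f(\pmb w)$ such that $$[\nabla f(\pmb w)-\pmb s(\pmb w)]^T(\pmb w-\pmb w^* )\le\tau,$$ where $\pmb w$ is any historical weight vector arising in the updates during SAPO training, and $\pmb s(\pmb w)=\mathbb E_{\pmb z}[\pmb s_{\pmb z}(\pmb w)]$ is the expectation of $\pmb s_{\pmb z}(\pmb w)$ over $\pmb z$. Since $\pmb s(\pmb w)$ can be made arbitrarily close to $\nabla f(\pmb w)$ by increasing the search parameter $n$, SAPO can use the smallest $n$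 for which the following holds: $$\tau\le\frac{c\epsilon}{2q}.$$ Let the learning rate be $$\gamma=\frac{c\epsilon-2\tau q}{\beta q\kappa^2},$$ where $\beta$ can be set to any value with $\beta\ge1$. Let $t$ be the smallest integer satisfying $$t\ge\frac{\beta q\kappa^2\log(q a_0/\epsilon)}{c(c\epsilon-2\tau q)},$$ where $a_0=\|\pmb w_0-\pmb w^*\|^2$ is the initial distance. Then, after $t$ updates of $\pmb w$, SAPO converges towards the optimum such that $$\mathbb E[f(\pmb w_t)-f(\pmb w^* )]\le\epsilon.$$
   Context: SAPO is a search-based probabilistic online learning algorithm for sequence labeling. Training data: $S=\{(\pmb x_i,\pmb y_i^* )\}_{i=1}^m$ is a training set with $|S|=m$ samples; each $\pmb y_i^*$ is the oracle label sequence of the input $\pmb x_i$. $\pmb F(\pmb x,\pmb y)$ is the feature vector of an input $\pmb x$ and an output label sequence $\pmb y$, $\pmb w\in\mathcal W$ is the vector of model weights ($\mathcal W$ being the space of weight vectors), $\|\cdot\|$ is the 2-norm, $R(\pmb w)$ is a weight regularization term (for example $L_2$), and $\lambda$ is the regularization strength. Objective function: $$P(\pmb y\mid\pmb x,\pmb w)=\frac{\exp[\pmb w^T\pmb F(\pmb x,\pmb y)]}{\sum_{\pmb y'}\exp[\pmb w^T\pmb F(\pmb x,\pmb y')]},$$ with the sum over all possible outputs $\pmb y'$ for $\pmb x$, and $$f(\pmb w)=-\sum_{i=1}^m\log P(\pmb y_i^*\mid\pmb x_i,\pmb w)+\lambda R(\pmb w).$$ When $f$ is strongly convex it has a global minimizer,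 denoted $\pmb w^*$. SAPO update term: let $n$ be the search parameter. For a sample $\pmb z=(\pmb x,\pmb y^* )$ and weights $\pmb w$, let $Y_n$ be the set of top-$n$ outputs for $\pmb x$ found by search based on $\pmb w$ (the $n$ outputs $\pmb y$ ranked highest by the score $\pmb w^T\pmb F(\pmb x,\pmb y)$). Define $$\pmb s_{\pmb z}(\pmb w)=-\Big\{\pmb F(\pmb x,\pmb y^* )-\sum_{\pmb y\in Y_n}\frac{\exp[\pmb w^T\pmb F(\pmb x,\pmb y)]}{\sum_{\pmb y'\in Y_n}\exp[\pmb w^T\pmb F(\pmb x,\pmb y')]}\,\pmb F(\pmb x,\pmb y)-\frac{\lambda}{|S|}\nabla R(\pmb w)\Big\}.$$ SAPO training: starting from $\pmb w_0$, at each step $t=0,1,2,\dots$ a sample $\pmb z_t$ is drawn at random from $S$, the draw being independent of $\pmb w_t$, and $\pmb w_{t+1}=\pmb w_t-\gamma\,\pmb s_{\pmb z_t}(\pmb w_t)$ with fixed learning rate $\gamma$. $\mathbb E_{\pmb z}$ is the expectation over a random sample $\pmb z$ drawn from $S$, and $\mathbb E$ is the expectation over the random draws in training.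
   Formalization: τ = cε/(2q) is excluded (γ > 0), since t is then undefined; the remark that s(w) gets arbitrarily close to ∇f(w) as n grows is false as defined (f is a sum over m samples, s a mean, so s → ∇f/m) and is not asserted: that n satisfies τ ≤ cε/(2q) is a hypothesis. *)

theory Defs
  imports "HOL-Probability.Probability"
begin

text \<open>
  Throughout, \<open>F x y\<close> is the feature vector, \<open>out x\<close> the finite set of all possible outputs for
  the input \<open>x\<close>, \<open>lam\<close> the regularization strength, and \<open>S\<close> the training set; a multiset, so that
  repeated samples are allowed, and \<open>size S\<close> is the number \<open>m\<close> of samples.
\<close>

definition grad :: "('a::real_inner \<Rightarrow> real) \<Rightarrow> 'a \<Rightarrow> 'a" where
  "grad f w = (THE D. GDERIV f w :> D)"

lemma grad_eqI: "GDERIV f w :> D \<Longrightarrow> grad f w = D"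
proof -
  assume D: "GDERIV f w :> D"
  have "E = D" if "GDERIV f w :> E" for E
  proof -
    have "(\<lambda>h. inner h E) = (\<lambda>h. inner h D)"
      using D that unfolding gderiv_def by (rule has_derivative_unique[rotated])
    then have "inner (E - D) E = inner (E - D) D" by meson
    then show "E = D" by (metis eq_iff_diff_eq_0 inner_diff_right inner_eq_zero_iff)
  qed
  with D show ?thesis unfolding grad_def by (rule the_equality)
qed

definition softmax :: "('x \<Rightarrow> 'y \<Rightarrow> real ^ 'd) \<Rightarrow> 'y set \<Rightarrow> 'x \<Rightarrow> real ^ 'd \<Rightarrow> 'y \<Rightarrow> real" where
  "softmax F Y x w y = exp (w \<bullet> F x y) / (\<Sum>y'\<in>Y. exp (w \<bullet> F x y'))"

definition objective ::
  "('x \<Rightarrow> 'y \<Rightarrow> real ^ 'd) \<Rightarrow> ('x \<Rightarrow> 'y set) \<Rightarrow> (real ^ 'd \<Rightarrow> real) \<Rightarrow> real \<Rightarrow> ('x \<times> 'y) multiset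
    \<Rightarrow> real ^ 'd \<Rightarrow> real" where
  "objective F out R lam S w =
    - (\<Sum>\<^sub># (image_mset (\<lambda>(x, y). ln (softmax F (out x) x w y)) S)) + lam * R w"

text \<open>
  Ties in the score may be broken arbitrarily; if there are fewer than \<open>n\<close> outputs, all are taken.
\<close>

definition is_top_n ::
  "('x \<Rightarrow> 'y \<Rightarrow> real ^ 'd) \<Rightarrow> ('x \<Rightarrow> 'y set) \<Rightarrow> nat \<Rightarrow> real ^ 'd \<Rightarrow> 'x \<Rightarrow> 'y set \<Rightarrow> bool" where
  "is_top_n F out n w x Y \<longleftrightarrow>
    Y \<subseteq> out x \<and> card Y = min n (card (out x)) \<and>
    (\<forall>y\<in>Y. \<forall>y'\<in>out x - Y. w \<bullet> F x y' \<le> w \<bullet> F x y)"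

text \<open>
  \<open>topn w x\<close> is the output set returned by the search for input \<open>x\<close> under weights \<open>w\<close>.
\<close>

definition sapo_dir ::
  "('x \<Rightarrow> 'y \<Rightarrow> real ^ 'd) \<Rightarrow> (real ^ 'd \<Rightarrow> 'x \<Rightarrow> 'y set) \<Rightarrow> (real ^ 'd \<Rightarrow> real) \<Rightarrow> real
    \<Rightarrow> ('x \<times> 'y) multiset \<Rightarrow> 'x \<times> 'y \<Rightarrow> real ^ 'd \<Rightarrow> real ^ 'd" where
  "sapo_dir F topn R lam S = (\<lambda>(x, ystar) w.
    - (F x ystar - (\<Sum>y\<in>topn w x. softmax F (topn w x) x w y *\<^sub>R F x y)
       - (lam / real (size S)) *\<^sub>R grad R w))"

text \<open>
  Training with update direction \<open>s z w\<close>, learning rate \<open>\<gamma>\<close> and the sequence of samples \<open>zs\<close>.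
\<close>

primrec sapo_iter ::
  "('z \<Rightarrow> real ^ 'd \<Rightarrow> real ^ 'd) \<Rightarrow> real \<Rightarrow> real ^ 'd \<Rightarrow> (nat \<Rightarrow> 'z) \<Rightarrow> nat \<Rightarrow> real ^ 'd" where
  "sapo_iter s \<gamma> w0 zs 0 = w0"
| "sapo_iter s \<gamma> w0 zs (Suc t) = sapo_iter s \<gamma> w0 zs t - \<gamma> *\<^sub>R s (zs t) (sapo_iter s \<gamma> w0 zs t)"

text \<open>The weight vectors that can arise in training on samples from \<open>S\<close>.\<close>

definition sapo_weights ::
  "('z \<Rightarrow> real ^ 'd \<Rightarrow> real ^ 'd) \<Rightarrow> real \<Rightarrow> real ^ 'd \<Rightarrow> 'z multiset \<Rightarrow> (real ^ 'd) set" where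
  "sapo_weights s \<gamma> w0 S = {sapo_iter s \<gamma> w0 zs t | zs t. \<forall>k. zs k \<in># S}"

text \<open>
  The library constant \<open>indep_var\<close> forces both random variables to have the same value type,
  hence this version, which is stated via the \<open>\<sigma>\<close>-algebras that they generate.
\<close>

definition indep_rv ::
  "'w measure \<Rightarrow> 'b measure \<Rightarrow> ('w \<Rightarrow> 'b) \<Rightarrow> 'c measure \<Rightarrow> ('w \<Rightarrow> 'c) \<Rightarrow> bool" where
  "indep_rv M N X N' Y \<longleftrightarrow>
    X \<in> measurable M N \<and> Y \<in> measurable M N' \<and>
    prob_space.indep_set M (sets (vimage_algebra (space M) X N)) (sets (vimage_algebra (space M) Y N'))"

end

theory Submission
  imports Defs
begin

text \<open>
  Let \<open>a k\<close> be the expected squared distance of the \<open>k\<close>-th iterate from the optimum. Expanding the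
  square and using independence of the draw, strong convexity and the bounds \<open>\<kappa>\<close> and \<open>\<tau>\<close> give
  \<open>a (k + 1) \<le> (1 - c \<gamma>) a k + 2 \<gamma> \<tau> + \<gamma>\<^sup>2 \<kappa>\<^sup>2\<close>, where the last two terms are at most \<open>c \<gamma> \<epsilon> / q\<close> by the
  choice of \<open>\<gamma>\<close>. Hence \<open>a t \<le> (1 - c \<gamma>)^t a 0 + \<epsilon> / q \<le> 2 \<epsilon> / q\<close>, and the objective exceeds its minimum
  by at most \<open>q / 2\<close> times the squared distance.

  The search may break ties non-measurably in the weights, so expectations over an iterate and
  the next draw are computed as finite sums: only finitely many weight vectors are reachable in
  \<open>k\<close> steps.
\<close>

subsection \<open>Lipschitz gradients\<close>

text \<open>
  The value \<open>f y\<close> lies between the linearizations with slopes \<open>g x\<close> and \<open>g y\<close>, and these differ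
  quadratically; so differentiability of \<open>f\<close> comes for free.
\<close>

lemma gderiv_of_lipschitz_subgradient:
  fixes f :: "'a::real_inner \<Rightarrow> real"
  assumes subgrad: "\<And>x y. f y \<ge> f x + (y - x) \<bullet> g x"
    and lipschitz: "q-lipschitz_on UNIV g"
  shows "GDERIV f x :> g x"
proof -
  have remainder: "norm (f y - f x - (y - x) \<bullet> g x) \<le> q * norm (y - x) * norm (y - x)" for y
  proof -
    have "f y - f x - (y - x) \<bullet> g x \<ge> 0"
      using subgrad[of x y] by simp
    moreover have "f y - f x - (y - x) \<bullet> g x \<le> (y - x) \<bullet> (g y - g x)"
      using subgrad[of y x] by (simp add: inner_diff_left inner_diff_right)
    moreover have "(y - x) \<bullet> (g y - g x) \<le> norm (y - x) * norm (g y - g x)"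
      by (rule norm_cauchy_schwarz)
    moreover have "\<dots> \<le> norm (y - x) * (q * norm (y - x))"
      using lipschitz_onD[OF lipschitz, of y x] by (intro mult_left_mono) (auto simp: dist_norm)
    ultimately show ?thesis by (simp add: mult_ac)
  qed
  have "((\<lambda>y. norm (f y - f x - (y - x) \<bullet> g x) / norm (y - x)) \<longlongrightarrow> 0) (at x)"
  proof (rule tendsto_sandwich)
    show "\<forall>\<^sub>F y in at x. 0 \<le> norm (f y - f x - (y - x) \<bullet> g x) / norm (y - x)"
      by simp
    show "\<forall>\<^sub>F y in at x. norm (f y - f x - (y - x) \<bullet> g x) / norm (y - x) \<le> q * norm (y - x)"
      unfolding eventually_at_filter using remainder
      by (auto simp: divide_le_eq intro!: always_eventually)
    have "((\<lambda>y. q * norm (y - x)) \<longlongrightarrow> q * norm (x - x)) (at x)"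
      by (intro tendsto_intros)
    then show "((\<lambda>y. q * norm (y - x)) \<longlongrightarrow> 0) (at x)" by simp
  qed simp
  then show ?thesis
    unfolding gderiv_def has_derivative_iff_norm
    by (auto intro: bounded_linear_inner_left)
qed

text \<open>Subtracting the linear and quadratic terms from \<open>f\<close> along the segment
  leaves a nonincreasing function \<open>\<phi>\<close>: Cauchy-Schwarz and the Lipschitz condition
  bound the change in slope by \<open>q * h * (norm d)\<^sup>2\<close>.\<close>

lemma lipschitz_gradient_upper_bound:
  fixes f :: "'a::real_inner \<Rightarrow> real"
  assumes gderiv: "\<And>x. GDERIV f x :> g x"
    and lipschitz: "q-lipschitz_on UNIV g"
  shows "f y \<le> f x + (y - x) \<bullet> g x + q / 2 * (norm (y - x))\<^sup>2"
proof -
  define d where "d = y - x"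
  define \<phi> where "\<phi> h = f (x + h *\<^sub>R d) - h * (d \<bullet> g x) - q / 2 * (norm d)\<^sup>2 * h\<^sup>2" for h
  have "\<phi> 1 \<le> \<phi> 0"
  proof (rule DERIV_nonpos_imp_nonincreasing[of 0 1 \<phi>])
    fix h :: real
    assume "0 \<le> h"
    have "(f has_derivative (\<lambda>v. v \<bullet> g (x + h *\<^sub>R d))) (at (x + h *\<^sub>R d))"
      using gderiv unfolding gderiv_def .
    then have "((\<lambda>h. f (x + h *\<^sub>R d)) has_derivative (\<lambda>r. (r *\<^sub>R d) \<bullet> g (x + h *\<^sub>R d))) (at h)"
      by (rule has_derivative_compose[rotated]) (auto intro!: derivative_eq_intros)
    then have "((\<lambda>h. f (x + h *\<^sub>R d)) has_real_derivative d \<bullet> g (x + h *\<^sub>R d)) (at h)"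
      by (simp add: has_field_derivative_def mult.commute[of _ "d \<bullet> g (x + h *\<^sub>R d)"])
    then have "(\<phi> has_real_derivative
        d \<bullet> g (x + h *\<^sub>R d) - d \<bullet> g x - q / 2 * (norm d)\<^sup>2 * (2 * h)) (at h)"
      unfolding \<phi>_def by (auto intro!: derivative_eq_intros)
    moreover have "d \<bullet> (g (x + h *\<^sub>R d) - g x) \<le> norm d * norm (g (x + h *\<^sub>R d) - g x)"
      by (rule norm_cauchy_schwarz)
    moreover have "\<dots> \<le> norm d * (q * (h * norm d))"
      using lipschitz_onD[OF lipschitz, of "x + h *\<^sub>R d" x] \<open>0 \<le> h\<close>
      by (intro mult_left_mono) (auto simp: dist_norm)
    ultimately show "\<exists>D. (\<phi> has_real_derivative D) (at h) \<and> D \<le> 0"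
      by (intro exI[of _ "d \<bullet> g (x + h *\<^sub>R d) - d \<bullet> g x - q / 2 * (norm d)\<^sup>2 * (2 * h)"] conjI)
        (simp_all add: inner_diff_right power2_eq_square mult_ac)
  qed simp
  then show ?thesis by (simp add: \<phi>_def d_def)
qed

text \<open>The gradient step of size \<open>1 / q\<close> minimizes the quadratic upper bound and
  lowers \<open>f\<close> by at least \<open>(norm (g x))\<^sup>2 / (2 * q)\<close>, so a nonzero
  gradient contradicts minimality.\<close>

lemma gradient_at_minimizer_eq_0:
  fixes f :: "'a::real_inner \<Rightarrow> real"
  assumes gderiv: "\<And>x. GDERIV f x :> g x"
    and lipschitz: "q-lipschitz_on UNIV g" and "q > 0"
    and minimizer: "\<And>y. f x \<le> f y"
  shows "g x = 0"
proof -
  have "f (x - (1 / q) *\<^sub>R g x) \<le>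
      f x + (- (1 / q) *\<^sub>R g x) \<bullet> g x + q / 2 * (norm (- (1 / q) *\<^sub>R g x))\<^sup>2"
    using lipschitz_gradient_upper_bound[OF gderiv lipschitz, of "x - (1 / q) *\<^sub>R g x" x] by simp
  also have "\<dots> = f x - (norm (g x))\<^sup>2 / (2 * q)"
    using \<open>q > 0\<close> by (simp add: dot_square_norm field_simps power2_eq_square)
  finally have "(norm (g x))\<^sup>2 / (2 * q) \<le> 0"
    using minimizer[of "x - (1 / q) *\<^sub>R g x"] by simp
  then show ?thesis using \<open>q > 0\<close> by (simp add: divide_le_0_iff)
qed

subsection \<open>Independent draws\<close>

text \<open>Almost everywhere \<open>Z\<close> is a finite combination of indicators of the events
  that \<open>X\<close> is \<open>a\<close> and \<open>Y\<close> is \<open>b\<close>, whose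
  probabilities factor by independence. Measurability is asked of \<open>Z\<close> only, so
  \<open>h\<close> may be arbitrary.\<close>

lemma (in prob_space) expectation_indep_finite:
  fixes Z :: "'a \<Rightarrow> real"
  assumes indep: "indep_rv M N X (count_space UNIV) Y"
    and distr_Y: "distr M (count_space UNIV) Y = measure_pmf p"
    and A: "finite A" "\<And>a. a \<in> A \<Longrightarrow> {a} \<in> sets N"
    and X: "AE \<omega> in M. X \<omega> \<in> A"
    and p: "finite (set_pmf p)"
    and Z[measurable]: "Z \<in> borel_measurable M"
    and Z_eq: "AE \<omega> in M. Z \<omega> = h (X \<omega>) (Y \<omega>)"
  shows "expectation Z = (\<Sum>a\<in>A. prob (X -` {a} \<inter> space M) * measure_pmf.expectation p (h a))"
proof -
  have [measurable]: "X \<in> measurable M N" "Y \<in> measurable M (count_space UNIV)"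
    and indep_sets: "indep_set (sets (vimage_algebra (space M) X N))
      (sets (vimage_algebra (space M) Y (count_space UNIV)))"
    using indep by (auto simp: indep_rv_def)
  let ?E = "\<lambda>a b. (X -` {a} \<inter> space M) \<inter> (Y -` {b} \<inter> space M)"
  have events: "?E a b \<in> events" if "a \<in> A" for a b
    using A(2)[OF that] by measurable
  have prob: "prob (?E a b) = prob (X -` {a} \<inter> space M) * pmf p b" if "a \<in> A" for a b
  proof -
    have "pmf p b = measure (distr M (count_space UNIV) Y) {b}"
      by (simp add: distr_Y measure_pmf_single)
    also have "\<dots> = prob (Y -` {b} \<inter> space M)"
      by (rule measure_distr) auto
    finally have "pmf p b = prob (Y -` {b} \<inter> space M)" .
    moreover have "prob (?E a b) = prob (X -` {a} \<inter> space M) * prob (Y -` {b} \<inter> space M)"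
      using A(2)[OF that] by (intro indep_setD[OF indep_sets] in_vimage_algebra) auto
    ultimately show ?thesis by simp
  qed
  have "AE b in distr M (count_space UNIV) Y. b \<in> set_pmf p"
    unfolding distr_Y by (rule AE_measure_pmf)
  then have Y: "AE \<omega> in M. Y \<omega> \<in> set_pmf p"
    by (rule AE_distrD[rotated]) simp
  have "expectation Z =
      expectation (\<lambda>\<omega>. \<Sum>a\<in>A. \<Sum>b\<in>set_pmf p. indicator (?E a b) \<omega> * h a b)"
  proof (rule integral_cong_AE)
    show "(\<lambda>\<omega>. \<Sum>a\<in>A. \<Sum>b\<in>set_pmf p. indicator (?E a b) \<omega> * h a b) \<in> borel_measurable M"
      using events by (intro borel_measurable_sum borel_measurable_times) auto
    show "AE \<omega> in M. Z \<omega> = (\<Sum>a\<in>A. \<Sum>b\<in>set_pmf p. indicator (?E a b) \<omega> * h a b)"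
      using X Y Z_eq AE_space
    proof eventually_elim
      case (elim \<omega>)
      \<comment> \<open>Only the pair of actual values survives, so the double sum collapses to one
        term.\<close>
      have "indicator (?E a b) \<omega> * h a b =
          (if a = X \<omega> then if b = Y \<omega> then h (X \<omega>) (Y \<omega>) else 0 else 0)" for a b
        using elim by (auto simp: indicator_def)
      then have "(\<Sum>b\<in>set_pmf p. indicator (?E a b) \<omega> * h a b) =
          (if a = X \<omega> then h (X \<omega>) (Y \<omega>) else 0)" for a
        using elim p by simp
      then show ?case using elim A(1) by simp
    qed
  qed simp
  also have "\<dots> = (\<Sum>a\<in>A. \<Sum>b\<in>set_pmf p. prob (?E a b) * h a b)"
    using events by (subst Bochner_Integration.integral_sum)
      (auto intro!: sum.cong Bochner_Integration.integrable_sum integrable_mult_left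
        integrable_real_indicator simp: emeasure_eq_measure Bochner_Integration.integral_sum)
  also have "\<dots> = (\<Sum>a\<in>A. prob (X -` {a} \<inter> space M) * measure_pmf.expectation p (h a))"
    using p by (intro sum.cong refl)
      (simp add: prob integral_measure_pmf[of "set_pmf p"] sum_distrib_left mult.assoc)
  finally show ?thesis .
qed

text \<open>This stands in for conditioning on \<open>X\<close>: both sides become sums over the
  values of \<open>X\<close> with the same weights, compared termwise by \<open>le\<close>.\<close>

lemma (in prob_space) expectation_indep_finite_mono:
  fixes Z Z' :: "'a \<Rightarrow> real"
  assumes indep: "indep_rv M N X (count_space UNIV) Y"
    and distr_Y: "distr M (count_space UNIV) Y = measure_pmf p"
    and A: "finite A" "\<And>a. a \<in> A \<Longrightarrow> {a} \<in> sets N"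
    and X: "AE \<omega> in M. X \<omega> \<in> A"
    and p: "finite (set_pmf p)"
    and Z: "Z \<in> borel_measurable M" "AE \<omega> in M. Z \<omega> = h (X \<omega>) (Y \<omega>)"
    and Z': "Z' \<in> borel_measurable M" "AE \<omega> in M. Z' \<omega> = k (X \<omega>)"
    and le: "\<And>a. a \<in> A \<Longrightarrow> measure_pmf.expectation p (h a) \<le> k a"
  shows "expectation Z \<le> expectation Z'"
proof -
  have "expectation Z =
      (\<Sum>a\<in>A. prob (X -` {a} \<inter> space M) * measure_pmf.expectation p (h a))"
    by (rule expectation_indep_finite[OF indep distr_Y A X p Z])
  also have "\<dots> \<le> (\<Sum>a\<in>A. prob (X -` {a} \<inter> space M) * k a)"
    using le by (intro sum_mono mult_left_mono) simp_all
  also have "\<dots> = expectation Z'"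
    using expectation_indep_finite[where h = "\<lambda>a b. k a", OF indep distr_Y A X p Z'] by simp
  finally show ?thesis .
qed

text \<open>Expanding the square, the cross term is linear in \<open>G u\<close> and passes through
  the expectation; only the last square is estimated.\<close>

lemma expectation_norm_diff_scaleR_le:
  fixes G :: "'z \<Rightarrow> 'a::euclidean_space"
  assumes p: "finite (set_pmf p)"
    and bound: "\<And>u. u \<in> set_pmf p \<Longrightarrow> norm (G u) \<le> \<kappa>"
  shows "measure_pmf.expectation p (\<lambda>u. (norm (d - \<gamma> *\<^sub>R G u))\<^sup>2)
    \<le> (norm d)\<^sup>2 - 2 * \<gamma> * (measure_pmf.expectation p G \<bullet> d) + \<gamma>\<^sup>2 * \<kappa>\<^sup>2"
proof -
  note [simp] = integrable_measure_pmf_finite[OF p]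
  have "measure_pmf.expectation p (\<lambda>u. (norm (d - \<gamma> *\<^sub>R G u))\<^sup>2)
      \<le> measure_pmf.expectation p (\<lambda>u. (norm d)\<^sup>2 - 2 * \<gamma> * (G u \<bullet> d) + \<gamma>\<^sup>2 * \<kappa>\<^sup>2)"
  proof (rule integral_mono_AE)
    show "AE u in p. (norm (d - \<gamma> *\<^sub>R G u))\<^sup>2 \<le> (norm d)\<^sup>2 - 2 * \<gamma> * (G u \<bullet> d) + \<gamma>\<^sup>2 * \<kappa>\<^sup>2"
    proof (rule AE_pmfI)
      fix u
      assume "u \<in> set_pmf p"
      then have "\<gamma>\<^sup>2 * (norm (G u))\<^sup>2 \<le> \<gamma>\<^sup>2 * \<kappa>\<^sup>2"
        using bound by (intro mult_left_mono power_mono) auto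
      then show "(norm (d - \<gamma> *\<^sub>R G u))\<^sup>2 \<le> (norm d)\<^sup>2 - 2 * \<gamma> * (G u \<bullet> d) + \<gamma>\<^sup>2 * \<kappa>\<^sup>2"
        unfolding power2_norm_eq_inner
        by (simp add: inner_diff_left inner_diff_right inner_commute power2_eq_square)
    qed
  qed simp_all
  also have "\<dots> = (norm d)\<^sup>2 - 2 * \<gamma> * (measure_pmf.expectation p G \<bullet> d) + \<gamma>\<^sup>2 * \<kappa>\<^sup>2"
    by simp
  finally show ?thesis .
qed

subsection \<open>Reachable weights\<close>

text \<open>Fixing the number of steps yields a finite set, which serves as the range of an iterate
  in the finite sums.\<close>

definition sapo_weights_at ::
  "('z \<Rightarrow> real ^ 'd \<Rightarrow> real ^ 'd) \<Rightarrow> real \<Rightarrow> real ^ 'd \<Rightarrow> 'z multiset \<Rightarrow> nat \<Rightarrow> (real ^ 'd) set" where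
  "sapo_weights_at s \<gamma> w0 S k = {sapo_iter s \<gamma> w0 zs k | zs. \<forall>j. zs j \<in># S}"

lemma sapo_weights_at_subset: "sapo_weights_at s \<gamma> w0 S k \<subseteq> sapo_weights s \<gamma> w0 S"
  by (auto simp: sapo_weights_at_def sapo_weights_def)

lemma finite_sapo_weights_at: "finite (sapo_weights_at s \<gamma> w0 S k)"
proof (induction k)
  case 0
  have "sapo_weights_at s \<gamma> w0 S 0 \<subseteq> {w0}"
    by (auto simp: sapo_weights_at_def)
  then show ?case by (rule finite_subset) simp
next
  case (Suc k)
  have "sapo_weights_at s \<gamma> w0 S (Suc k)
      \<subseteq> (\<lambda>(v, u). v - \<gamma> *\<^sub>R s u v) ` (sapo_weights_at s \<gamma> w0 S k \<times> set_mset S)"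
    by (force simp: sapo_weights_at_def)
  then show ?case by (rule finite_subset) (simp add: Suc)
qed

subsection \<open>The convergence bound\<close>

text \<open>The affine map has fixed point \<open>b\<close>, and the excess over \<open>b\<close>
  shrinks by the factor \<open>1 - r\<close> in each step; as \<open>b\<close> is nonnegative, the
  initial excess is at most \<open>a 0\<close>.\<close>

lemma affine_recursion_le:
  fixes a :: "nat \<Rightarrow> real"
  assumes step: "\<And>k. a (Suc k) \<le> (1 - r) * a k + r * b" and "r \<le> 1" and "b \<ge> 0"
  shows "a k \<le> (1 - r) ^ k * a 0 + b"
proof (induction k)
  case 0
  then show ?case using \<open>b \<ge> 0\<close> by simp
next
  case (Suc k)
  have "a (Suc k) \<le> (1 - r) * ((1 - r) ^ k * a 0 + b) + r * b"
    using step[of k] mult_left_mono[OF Suc, of "1 - r"] \<open>r \<le> 1\<close> by simp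
  also have "\<dots> = (1 - r) ^ Suc k * a 0 + b"
    by (simp add: algebra_simps)
  finally show ?case .
qed

text \<open>This follows from \<open>1 - r \<le> exp (- r)\<close>. The case of zero
  \<open>a\<close> is split off because \<open>exp\<close> and \<open>ln\<close> cancel only at a
  positive \<open>a / B\<close>.\<close>

lemma one_minus_power_mult_le:
  fixes r a B :: real
  assumes "r \<le> 1" "a \<ge> 0" "B > 0" and t: "r * real t \<ge> ln (a / B)"
  shows "(1 - r) ^ t * a \<le> B"
proof (cases "a = 0")
  case False
  have "(1 - r) ^ t \<le> exp (- r) ^ t"
    using exp_ge_add_one_self[of "- r"] \<open>r \<le> 1\<close> by (intro power_mono) auto
  also have "\<dots> = exp (- (r * real t))"
    by (simp add: exp_of_nat_mult[symmetric] mult.commute)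
  also have "\<dots> \<le> exp (- ln (a / B))"
    using t by simp
  also have "\<dots> = B / a"
    using False assms by (simp add: exp_minus)
  finally show ?thesis using False assms by (simp add: field_simps)
qed (use assms in simp)

theorem theorem1:
  fixes F :: "'x \<Rightarrow> 'y \<Rightarrow> real ^ 'd"
    and out :: "'x \<Rightarrow> 'y set"
    and S :: "('x \<times> 'y) multiset"
    and R :: "real ^ 'd \<Rightarrow> real"
    and topn :: "real ^ 'd \<Rightarrow> 'x \<Rightarrow> 'y set"
    and lam c q \<kappa> \<gamma> \<epsilon> \<tau> \<beta> a0 :: real
    and n t :: nat
    and w0 wstar :: "real ^ 'd"
    and f :: "real ^ 'd \<Rightarrow> real"
    and s :: "'x \<times> 'y \<Rightarrow> real ^ 'd \<Rightarrow> real ^ 'd"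
    and M :: "'\<omega> measure"
    and z :: "nat \<Rightarrow> '\<omega> \<Rightarrow> 'x \<times> 'y"
    and w :: "nat \<Rightarrow> '\<omega> \<Rightarrow> real ^ 'd"
  assumes S_nonempty: "S \<noteq> {#}"
    and out_finite: "\<And>x y. (x, y) \<in># S \<Longrightarrow> finite (out x)"
    and oracle_in_out: "\<And>x y. (x, y) \<in># S \<Longrightarrow> y \<in> out x"
    and R_differentiable: "\<And>v. R differentiable (at v)"
    and f_eq: "f = objective F out R lam S"
    and top_n_search: "\<And>v x y. (x, y) \<in># S \<Longrightarrow> is_top_n F out n v x (topn v x)"
    and s_eq: "s = sapo_dir F topn R lam S"
    \<comment> \<open>training\<close>
    and prob_space: "prob_space M"
    and iterates: "\<And>k \<omega>. w k \<omega> = sapo_iter s \<gamma> w0 (\<lambda>j. z j \<omega>) k"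
    and draw_distr: "\<And>k. distr M (count_space UNIV) (z k) = measure_pmf (pmf_of_multiset S)"
    and draw_indep: "\<And>k. indep_rv M borel (w k) (count_space UNIV) (z k)"
    \<comment> \<open>the assumptions (i)--(iv)\<close>
    and c_pos: "c > 0"
    and strongly_convex:
      "\<And>v v'. f v' \<ge> f v + (v' - v) \<bullet> grad f v + c / 2 * (norm (v' - v))\<^sup>2"
    and lipschitz: "q-lipschitz_on UNIV (grad f)"
    and \<kappa>_pos: "\<kappa> > 0"
    and s_bounded: "\<And>v u. v \<in> sapo_weights s \<gamma> w0 S \<Longrightarrow> u \<in># S \<Longrightarrow> norm (s u v) \<le> \<kappa>"
    and \<gamma>_c: "\<gamma> * c < 1"
    \<comment> \<open>optimum, approximation bound and parameters\<close>
    and minimizer: "\<And>v. f wstar \<le> f v"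
    and \<epsilon>_pos: "\<epsilon> > 0"
    and approximation: "\<And>v. v \<in> sapo_weights s \<gamma> w0 S \<Longrightarrow>
      (grad f v - measure_pmf.expectation (pmf_of_multiset S) (\<lambda>u. s u v)) \<bullet> (v - wstar) \<le> \<tau>"
    and \<tau>_le: "\<tau> \<le> c * \<epsilon> / (2 * q)"
    and \<beta>_ge: "\<beta> \<ge> 1"
    and \<gamma>_eq: "\<gamma> = (c * \<epsilon> - 2 * \<tau> * q) / (\<beta> * q * \<kappa>\<^sup>2)"
    and \<gamma>_pos: "\<gamma> > 0"
    and a0_eq: "a0 = (norm (w0 - wstar))\<^sup>2"
    and t_eq: "t = (LEAST k::nat. real k \<ge> \<beta> * q * \<kappa>\<^sup>2 * ln (q * a0 / \<epsilon>) / (c * (c * \<epsilon> - 2 * \<tau> * q)))"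
  shows "prob_space.expectation M (\<lambda>\<omega>. f (w t \<omega>) - f wstar) \<le> \<epsilon>"
proof -
  interpret prob_space M by (rule prob_space)
  define p where "p = pmf_of_multiset S"
  have set_p: "set_pmf p = set_mset S"
    using S_nonempty by (simp add: p_def)
  have "q \<ge> 0" using lipschitz by (simp add: lipschitz_on_def)
  \<comment> \<open>Division by zero gives 0, so \<open>q = 0\<close> would force
    \<open>\<gamma> = 0\<close>.\<close>
  with \<gamma>_pos \<gamma>_eq have q: "q > 0" by (cases "q = 0") auto
  have \<gamma>_mult: "\<gamma> * (\<beta> * q * \<kappa>\<^sup>2) = c * \<epsilon> - 2 * \<tau> * q"
    using \<gamma>_eq \<beta>_ge q \<kappa>_pos by simp
  \<comment> \<open>The errors from approximation and from sampling together take the form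
    \<open>r * b\<close> of \<open>affine_recursion_le\<close>, with \<open>r = \<gamma> * c\<close>
    and \<open>b = \<epsilon> / q\<close>.\<close>
  have noise: "2 * \<gamma> * \<tau> + \<gamma>\<^sup>2 * \<kappa>\<^sup>2 \<le> \<gamma> * c * (\<epsilon> / q)"
  proof -
    have "1 * (\<gamma> * q * \<kappa>\<^sup>2) \<le> \<beta> * (\<gamma> * q * \<kappa>\<^sup>2)"
      using \<beta>_ge \<gamma>_pos q by (intro mult_right_mono) auto
    then have "2 * \<tau> * q + \<gamma> * q * \<kappa>\<^sup>2 \<le> c * \<epsilon>"
      using \<gamma>_mult by (simp add: mult_ac)
    then have "\<gamma> * (2 * \<tau> * q + \<gamma> * q * \<kappa>\<^sup>2) \<le> \<gamma> * (c * \<epsilon>)"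
      using \<gamma>_pos by (intro mult_left_mono) auto
    then show ?thesis using q by (simp add: field_simps power2_eq_square)
  qed
  \<comment> \<open>Without its quadratic term, strong convexity is the subgradient inequality. It
    shows that \<open>grad f v\<close>, so far only a description by \<open>THE\<close>, is the
    actual gradient.\<close>
  have "f v + (v' - v) \<bullet> grad f v \<le> f v'" for v v'
  proof -
    have "0 \<le> c / 2 * (norm (v' - v))\<^sup>2" using c_pos by simp
    then show ?thesis using strongly_convex[of v v'] by linarith
  qed
  then have gderiv: "GDERIV f v :> grad f v" for v
    by (intro gderiv_of_lipschitz_subgradient[OF _ lipschitz])
  have grad_wstar: "grad f wstar = 0"
    using gradient_at_minimizer_eq_0[OF gderiv lipschitz q minimizer] .
  have gap: "f v - f wstar \<le> q / 2 * (norm (v - wstar))\<^sup>2" for v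
    using lipschitz_gradient_upper_bound[OF gderiv lipschitz, of v wstar] grad_wstar by simp
  have grad_ge: "c / 2 * (norm (v - wstar))\<^sup>2 \<le> grad f v \<bullet> (v - wstar)" for v
  proof -
    have "f wstar \<ge> f v - grad f v \<bullet> (v - wstar) + c / 2 * (norm (v - wstar))\<^sup>2"
      using strongly_convex[of v wstar]
      by (simp add: inner_diff_left inner_diff_right inner_commute norm_minus_commute)
    then show ?thesis using minimizer[of v] by linarith
  qed

  have one_step: "measure_pmf.expectation p (\<lambda>u. (norm (v - \<gamma> *\<^sub>R s u v - wstar))\<^sup>2)
      \<le> (1 - \<gamma> * c) * (norm (v - wstar))\<^sup>2 + \<gamma> * c * (\<epsilon> / q)"
    if v: "v \<in> sapo_weights s \<gamma> w0 S" for v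
  proof -
    let ?Es = "measure_pmf.expectation p (\<lambda>u. s u v)"
    have swap: "v - \<gamma> *\<^sub>R s u v - wstar = (v - wstar) - \<gamma> *\<^sub>R s u v" for u
      by simp
    have "measure_pmf.expectation p (\<lambda>u. (norm (v - \<gamma> *\<^sub>R s u v - wstar))\<^sup>2)
        \<le> (norm (v - wstar))\<^sup>2 - 2 * \<gamma> * (?Es \<bullet> (v - wstar)) + \<gamma>\<^sup>2 * \<kappa>\<^sup>2"
      unfolding swap using s_bounded[OF v] set_p
      by (intro expectation_norm_diff_scaleR_le) auto
    \<comment> \<open>Passing from the true gradient to the expected update direction costs at most
      \<open>\<tau>\<close>.\<close>
    moreover have "c / 2 * (norm (v - wstar))\<^sup>2 - \<tau> \<le> ?Es \<bullet> (v - wstar)"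
      using approximation[OF v] grad_ge[of v] by (simp add: p_def inner_diff_left)
    then have "2 * \<gamma> * (c / 2 * (norm (v - wstar))\<^sup>2 - \<tau>) \<le> 2 * \<gamma> * (?Es \<bullet> (v - wstar))"
      using \<gamma>_pos by (intro mult_left_mono) auto
    ultimately show ?thesis using noise by (simp add: algebra_simps)
  qed

  have w_meas[measurable]: "w k \<in> borel_measurable M"
    and z_meas: "z k \<in> measurable M (count_space UNIV)" for k
    using draw_indep[of k] by (auto simp: indep_rv_def)
  \<comment> \<open>The law of a draw puts it in \<open>S\<close> only up to a null set; countably
    many such sets are discarded together.\<close>
  have "AE \<omega> in M. z k \<omega> \<in># S" for k
  proof (rule AE_distrD[OF z_meas])
    show "AE u in distr M (count_space UNIV) (z k). u \<in># S"
      unfolding draw_distr using set_p by (auto simp: p_def intro!: AE_pmfI)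
  qed
  then have "AE \<omega> in M. \<forall>k. z k \<omega> \<in># S"
    by (simp add: AE_all_countable)
  then have reach: "AE \<omega> in M. w k \<omega> \<in> sapo_weights_at s \<gamma> w0 S k" for k
    by eventually_elim (auto simp: sapo_weights_at_def iterates)

  let ?D = "\<lambda>k \<omega>. (norm (w k \<omega> - wstar))\<^sup>2"
  have int: "integrable M (?D k)" for k
  proof (rule integrable_const_bound)
    \<comment> \<open>The sum over all reachable vectors dominates each of its nonnegative
      terms.\<close>
    let ?B = "\<Sum>v\<in>sapo_weights_at s \<gamma> w0 S k. (norm (v - wstar))\<^sup>2"
    show "AE \<omega> in M. norm (?D k \<omega>) \<le> ?B"
      using reach[of k]
    proof eventually_elim
      case (elim \<omega>)
      then show ?case
        using member_le_sum[of "w k \<omega>" "sapo_weights_at s \<gamma> w0 S k" "\<lambda>v. (norm (v - wstar))\<^sup>2"]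
        by (simp add: finite_sapo_weights_at)
    qed
  qed simp
  have rec: "expectation (?D (Suc k)) \<le> (1 - \<gamma> * c) * expectation (?D k) + \<gamma> * c * (\<epsilon> / q)" for k
  proof -
    have "expectation (?D (Suc k))
      \<le> expectation (\<lambda>\<omega>. (1 - \<gamma> * c) * ?D k \<omega> + \<gamma> * c * (\<epsilon> / q))"
    proof (intro expectation_indep_finite_mono[OF draw_indep[of k] draw_distr[of k, folded p_def]
            finite_sapo_weights_at _ reach,
            where h = "\<lambda>v u. (norm (v - \<gamma> *\<^sub>R s u v - wstar))\<^sup>2"
            and k = "\<lambda>v. (1 - \<gamma> * c) * (norm (v - wstar))\<^sup>2 + \<gamma> * c * (\<epsilon> / q)"])
      show "AE \<omega> in M. ?D (Suc k) \<omega> = (norm (w k \<omega> - \<gamma> *\<^sub>R s (z k \<omega>) (w k \<omega>) - wstar))\<^sup>2"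
        by (simp add: iterates)
      show "measure_pmf.expectation p (\<lambda>u. (norm (v - \<gamma> *\<^sub>R s u v - wstar))\<^sup>2)
          \<le> (1 - \<gamma> * c) * (norm (v - wstar))\<^sup>2 + \<gamma> * c * (\<epsilon> / q)"
        if "v \<in> sapo_weights_at s \<gamma> w0 S k" for v
        using that sapo_weights_at_subset by (intro one_step) blast
    qed (simp_all add: set_p)
    also have "\<dots> = (1 - \<gamma> * c) * expectation (?D k) + \<gamma> * c * (\<epsilon> / q)"
      using int by (simp add: prob_space)
    finally show ?thesis .
  qed
  have D_le: "expectation (?D t) \<le> (1 - \<gamma> * c) ^ t * a0 + \<epsilon> / q"
    using affine_recursion_le[of "\<lambda>k. expectation (?D k)" "\<gamma> * c" "\<epsilon> / q" t, OF rec] \<gamma>_c q \<epsilon>_pos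
    by (simp add: iterates a0_eq prob_space)

  have "real t \<ge> \<beta> * q * \<kappa>\<^sup>2 * ln (q * a0 / \<epsilon>) / (c * (c * \<epsilon> - 2 * \<tau> * q))"
    unfolding t_eq by (rule LeastI_ex) (rule real_arch_simple)
  \<comment> \<open>By the choice of \<open>\<gamma>\<close>, the threshold for \<open>t\<close> is
    the number of contractions by \<open>1 - \<gamma> * c\<close> that brings \<open>a0\<close> down
    to \<open>\<epsilon> / q\<close>.\<close>
  also have "\<beta> * q * \<kappa>\<^sup>2 * ln (q * a0 / \<epsilon>) / (c * (c * \<epsilon> - 2 * \<tau> * q)) = ln (a0 / (\<epsilon> / q)) / (\<gamma> * c)"
    unfolding \<gamma>_mult[symmetric] using \<beta>_ge q \<kappa>_pos c_pos \<gamma>_pos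
    by (simp add: field_simps)
  finally have "\<gamma> * c * real t \<ge> ln (a0 / (\<epsilon> / q))"
    using \<gamma>_pos c_pos by (simp add: field_simps)
  then have "(1 - \<gamma> * c) ^ t * a0 \<le> \<epsilon> / q"
    using \<gamma>_c q \<epsilon>_pos by (intro one_minus_power_mult_le) (auto simp: a0_eq)
  with D_le have D_le: "expectation (?D t) \<le> 2 * \<epsilon> / q" by simp

  \<comment> \<open>An integrable nonnegative majorant suffices, since a non-integrable left side
    would have integral 0.\<close>
  have "expectation (\<lambda>\<omega>. f (w t \<omega>) - f wstar) \<le> expectation (\<lambda>\<omega>. q / 2 * ?D t \<omega>)"
    using int gap q by (intro integral_mono') auto
  also have "\<dots> = q / 2 * expectation (?D t)"
    by simp
  also have "\<dots> \<le> q / 2 * (2 * \<epsilon> / q)"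
    using D_le q by (intro mult_left_mono) auto
  also have "\<dots> = \<epsilon>"
    using q by simp
  finally show ?thesis .
qed

end
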